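(* Let $s,p\in\mathbb{N}=\{1,2,3,\dots\}$, and let $\mathcal{A}=(a_{ij})\in\mathbb{R}^{s\times s}$ and $b=(b_1,\ldots,b_s)^T\in\mathbb{R}^s$ be the coefficients of an $s$-stage Runge-Kutta method. Suppose that the order conditions $$b^T\mathcal{A}^{(\beta)}=\frac{1}{\beta!}$$ are satisfied for all rooted trees $\beta$ of order $\#\beta\le p$. Then the Runge-Kutta method $(b,\mathcal{A})$ is of order $p$ for all $f\in C^p(\Omega,\mathbb{R}^d)$; that is, for every $d\in\mathbb{N}$, every open $\Omega\subset\mathbb{R}^d$, every $f\in C^p(\Omega,\mathbb{R}^d)$ and every $x\in\Omega$, $$\Phi^\tau x-\Psi^\tau x=O(\tau^{p+1})\qquad(\tau\to0),$$ where $\Phi^\tau x$ is the flow of the autonomous system $x'=f(x)$ and $\Psi^\tau x$ is the discrete flow of the Runge-Kutta method.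
   Context: Rooted trees are defined recursively: a rooted tree is a finite unordered list (multiset) $\beta=[\beta_1,\ldots,\beta_n]$, $n\ge0$, of rooted trees (the subtrees obtained by removing the root); the empty list $\odot=[\,]$ is the tree consisting of a single root. The order (number of nodes) is $\#\beta=1+\#\beta_1+\ldots+\#\beta_n$, so $\#\odot=1$. Empty products equal $1$ and empty sums equal $0$. Tree factorial: for $\beta=[\beta_1,\ldots,\beta_n]$, recursively $\beta!=(\#\beta)\,\beta_1!\cdot\ldots\cdot\beta_n!$. The vector $\mathcal{A}^{(\beta)}\in\mathbb{R}^s$ for $\beta=[\beta_1,\ldots,\beta_n]$ is defined recursively by $$\mathcal{A}^{(\beta)}_i=\left(\mathcal{A}\cdot\mathcal{A}^{(\beta_1)}\right)_i\cdot\ldots\cdot\left(\mathcal{A}\cdot\mathcal{A}^{(\beta_n)}\right)_i,\qquad i=1,\ldots,s,$$ so that $\mathcal{A}^{(\odot)}=(1,\ldots,1)^T$. Flow: $\Phi^\tau x$ is the value at time $\tau$ of the solution of $x'=f(x)$ starting from $x$ at time $0$ (defined for $|\tau|$ small), i.e. $\Phi^\tau x=x+\int_0^\tau f(\Phi^\sigma x)\,d\sigma$. Discrete flow: $\Psi^\tau x=x+\tau\sum_{i=1}^s b_ik_i$, where the stages $k_1,\ldots,k_s\in\mathbb{R}^d$ (depending on $\tau$ and $x$) satisfy $$k_i=f\Bigl(x+\tau\sum_{j=1}^s a_{ij}k_j\Bigr),\qquad i=1,\ldots,s.$$ The method need not be explicit ($\mathcal{A}$ is not assumed strictly lower triangular);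 for small $|\tau|$ the stages denote the solution of this system that remains bounded as $\tau\to0$ (for $f\in C^1$ it exists and is unique for all sufficiently small $|\tau|$). The $O$-term is for fixed $f$ and $x$ as $\tau\to0$. *)

theory Defs
  imports "HOL-Analysis.Analysis" "HOL-Library.Multiset" "HOL-Library.Landau_Symbols"
begin

datatype rtree = Node "rtree multiset"

primrec tree_order :: "rtree \<Rightarrow> nat" where
  "tree_order (Node B) = 1 + (\<Sum>m\<in>#image_mset tree_order B. m)"

primrec tree_factorial :: "rtree \<Rightarrow> nat" where
  "tree_factorial (Node B) = tree_order (Node B) * (\<Prod>m\<in>#image_mset tree_factorial B. m)"

primrec rk_weights :: "real ^ 's ^ 's \<Rightarrow> rtree \<Rightarrow> real ^ 's" where
  "rk_weights A (Node B) = (\<chi> i. \<Prod>v\<in>#image_mset (rk_weights A) B. (A *v v) $ i)"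

text \<open>
  The class \<open>C\<^sup>k\<close> on an open set: \<open>f\<close> is continuous, respectively Frechet
  differentiable with every directional derivative of class \<open>C\<^sup>k\<close>. In finite dimensions
  this is \<open>k\<close>-fold continuous differentiability; only the values of \<open>f\<close> on the open
  set matter.
\<close>

primrec C_on :: "nat \<Rightarrow> 'a::euclidean_space set \<Rightarrow> ('a \<Rightarrow> 'b::euclidean_space) \<Rightarrow> bool" where
  "C_on 0 S f \<longleftrightarrow> continuous_on S f"
| "C_on (Suc k) S f \<longleftrightarrow> (\<forall>x\<in>S. f differentiable (at x)) \<and>
     (\<forall>v. C_on k S (\<lambda>x. frechet_derivative f (at x) v))"

text \<open>
  The flow and the discrete flow are only determined for small \<open>\<tau>\<close>, so they are
  given by predicates on total functions of \<open>\<tau>\<close> whose values away from \<open>0\<close> are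
  unconstrained. For \<open>f\<close> of class \<open>C\<^sup>1\<close> on the open set \<open>\<Omega>\<close>
  containing \<open>x\<close>, both objects exist and are unique near \<open>0\<close>.
\<close>

definition is_flow ::
  "(real ^ 'd) set \<Rightarrow> (real ^ 'd \<Rightarrow> real ^ 'd) \<Rightarrow> real ^ 'd \<Rightarrow> (real \<Rightarrow> real ^ 'd) \<Rightarrow> bool" where
  "is_flow \<Omega> f x \<Phi> \<longleftrightarrow> \<Phi> 0 = x \<and>
     (\<exists>\<epsilon>>0. \<forall>\<tau>. \<bar>\<tau>\<bar> < \<epsilon> \<longrightarrow> \<Phi> \<tau> \<in> \<Omega> \<and> (\<Phi> has_vector_derivative f (\<Phi> \<tau>)) (at \<tau>))"

definition rk_stages ::
  "real ^ 's ^ 's \<Rightarrow> (real ^ 'd) set \<Rightarrow> (real ^ 'd \<Rightarrow> real ^ 'd) \<Rightarrow> real ^ 'd \<Rightarrow> real \<Rightarrow>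
     real ^ 'd ^ 's \<Rightarrow> bool" where
  "rk_stages A \<Omega> f x \<tau> k \<longleftrightarrow>
     (\<forall>i. x + \<tau> *\<^sub>R (\<Sum>j\<in>UNIV. A $ i $ j *\<^sub>R k $ j) \<in> \<Omega> \<and>
          k $ i = f (x + \<tau> *\<^sub>R (\<Sum>j\<in>UNIV. A $ i $ j *\<^sub>R k $ j)))"

text \<open>
  For an implicit method the stage equations at a fixed \<open>\<tau>\<close> can have several solutions;
  boundedness as \<open>\<tau> \<rightarrow> 0\<close> selects the intended one.
\<close>

definition is_discrete_flow ::
  "real ^ 's ^ 's \<Rightarrow> real ^ 's \<Rightarrow> (real ^ 'd) set \<Rightarrow> (real ^ 'd \<Rightarrow> real ^ 'd) \<Rightarrow> real ^ 'd \<Rightarrow>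
     (real \<Rightarrow> real ^ 'd) \<Rightarrow> bool" where
  "is_discrete_flow A b \<Omega> f x \<Psi> \<longleftrightarrow>
     (\<exists>k. Bfun k (at 0) \<and>
          (\<forall>\<^sub>F \<tau> in at 0. rk_stages A \<Omega> f x \<tau> (k \<tau>) \<and>
             \<Psi> \<tau> = x + \<tau> *\<^sub>R (\<Sum>i\<in>UNIV. b $ i *\<^sub>R k \<tau> $ i)))"

end

theory Submission
  imports Defs
begin

text \<open>
  The slopes of the flow and the stages of the method solve the same fixed point equation
  \<open>K = f (x + J K)\<close>, where \<open>J\<close> integrates from \<open>0\<close> in the first
  case and is multiplication by \<open>\<tau>\<close> and the matrix in the second. For each tree,
  pair the corresponding monomials in \<open>\<tau>\<close> of both problems. As the monomials
  of two trees multiply to the monomial of the tree with the roots identified, and \<open>J\<close>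
  maps the monomial of a tree to that of the tree with a new root put below, the
  linear span of the pairs is an algebra invariant under \<open>J\<close>. Replacing \<open>f\<close>
  by Taylor polynomials, one gains a power of \<open>\<tau>\<close> with every step of the fixed
  point iteration, so both solutions have one common expansion in the span up to
  \<open>O(\<tau>\<^sup>p)\<close>. The order conditions say that exact and discrete quadrature agree on the
  pairs of the trees with at most \<open>p\<close> nodes, and on all other pairs they
  differ by \<open>O(\<tau>\<^sup>p\<^sup>+\<^sup>1)\<close>. No combinatorial tree coefficients are needed.
\<close>

section \<open>Tree monomials and the algebra they span\<close>

text \<open>
  The index \<open>None\<close> stands for the exact flow, \<open>Some j\<close> for the stage \<open>j\<close>.
\<close>

definition tree_monomial :: "real ^ 's ^ 's \<Rightarrow> rtree \<Rightarrow> 's option \<Rightarrow> real \<Rightarrow> real" where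
  "tree_monomial A \<beta> i \<tau> = \<tau> ^ (tree_order \<beta> - 1) *
     (case i of None \<Rightarrow> real (tree_order \<beta>) / real (tree_factorial \<beta>)
              | Some j \<Rightarrow> rk_weights A \<beta> $ j)"

text \<open>The linear span of the monomials. The scalar \<open>c\<close> does not depend on
  \<open>i\<close>, so a member is one linear combination of trees shared by the exact flow and all
  stages.\<close>

inductive tree_sum :: "real ^ 's ^ 's \<Rightarrow> ('s option \<Rightarrow> real \<Rightarrow> real) \<Rightarrow> bool" for A where
  monomial: "tree_sum A (tree_monomial A \<beta>)"
| add: "tree_sum A F \<Longrightarrow> tree_sum A G \<Longrightarrow> tree_sum A (\<lambda>i \<tau>. F i \<tau> + G i \<tau>)"
| scale: "tree_sum A F \<Longrightarrow> tree_sum A (\<lambda>i \<tau>. c * F i \<tau>)"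

text \<open>Makes the subtraction in the exponent \<open>tree_order \<beta> - 1\<close> a true one
  and rules out trees of order 0.\<close>

lemma tree_order_pos: "0 < tree_order \<beta>"
  by (cases \<beta>) simp

lemma tree_monomial_empty: "tree_monomial A (Node {#}) i \<tau> = 1"
  by (simp add: tree_monomial_def split: option.split)

text \<open>The factor that the recursion of the factorial contributes at the root cancels, so the
  exact coefficient is, like \<open>rk_weights\<close>, a product over the subtrees.\<close>

lemma order_div_factorial:
  "real (tree_order (Node B)) / real (tree_factorial (Node B)) =
     1 / real (\<Prod>m\<in>#image_mset tree_factorial B. m)"
  using tree_order_pos[of "Node B"] by (simp del: tree_order.simps)

text \<open>Both kinds of coefficients are products over the multiset of subtrees and the exponent
  is the sum of their orders, so uniting the multisets multiplies the monomials.\<close>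

lemma tree_monomial_mult:
  "tree_monomial A (Node B) i \<tau> * tree_monomial A (Node C) i \<tau> = tree_monomial A (Node (B + C)) i \<tau>"
  by (cases i)
    (simp_all only: tree_monomial_def option.case order_div_factorial rk_weights.simps vec_lambda_beta,
     simp_all add: power_add)

lemma tree_sum_const: "tree_sum A (\<lambda>i \<tau>. c)"
  using tree_sum.scale[OF tree_sum.monomial[of A "Node {#}"], of c]
  by (simp add: tree_monomial_empty)

lemma tree_sum_mult:
  assumes "tree_sum A F" "tree_sum A G"
  shows "tree_sum A (\<lambda>i \<tau>. F i \<tau> * G i \<tau>)"
  using assms
proof (induction F)
  case (monomial \<beta>)
  then show ?case
  proof (induction G)
    case (monomial \<gamma>)
    obtain B C where "\<beta> = Node B" "\<gamma> = Node C" by (metis rtree.exhaust)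
    then show ?case by (simp add: tree_monomial_mult tree_sum.monomial)
  next
    case (add F G)
    then show ?case using tree_sum.add by (simp add: distrib_left)
  next
    case (scale F c)
    then show ?case using tree_sum.scale[OF scale.IH, of c] by (simp add: mult.left_commute)
  qed
next
  case (add F G)
  then show ?case using tree_sum.add by (simp add: distrib_right)
next
  case (scale F c)
  then show ?case using tree_sum.scale[OF scale.IH[OF scale.prems], of c] by (simp add: mult.assoc)
qed

text \<open>Members of the span are polynomials in \<open>\<tau>\<close>, hence continuous at
  0.\<close>

lemma tree_sum_bounded:
  assumes "tree_sum A F"
  shows "F i \<in> O[at 0](\<lambda>_. 1)"
proof -
  have "isCont (F i) 0"
    using assms by induction (simp_all add: tree_monomial_def[abs_def])
  then show ?thesis
    by (intro bigoI_tendsto[where c = "F i 0"]) (simp_all add: isCont_def)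
qed

section \<open>The operator J on the span and the quadrature defect\<close>

text \<open>
  \<open>H = J F\<close>; a relation, since \<open>F None\<close> need only have a primitive near \<open>0\<close>.
\<close>

definition rk_lift ::
  "real ^ 's ^ 's \<Rightarrow> ('s::finite option \<Rightarrow> real \<Rightarrow> real) \<Rightarrow> ('s option \<Rightarrow> real \<Rightarrow> real) \<Rightarrow> bool" where
  "rk_lift A F H \<longleftrightarrow> H None 0 = 0 \<and>
     (\<forall>\<^sub>F \<tau> in nhds 0. (H None has_real_derivative F None \<tau>) (at \<tau>)) \<and>
     (\<forall>\<^sub>F \<tau> in at 0. \<forall>i. H (Some i) \<tau> = \<tau> * (\<Sum>j\<in>UNIV. A $ i $ j * F (Some j) \<tau>))"

text \<open>By \<open>order_div_factorial\<close>, the exact monomial of the tree with the new root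
  is \<open>\<tau> ^ tree_order \<beta> / tree_factorial \<beta>\<close>; differentiation brings
  down the factor \<open>tree_order \<beta>\<close> of the exact monomial of \<open>\<beta>\<close>.
  For the stages this is the recursion of \<open>rk_weights\<close>.\<close>

lemma rk_lift_monomial: "rk_lift A (tree_monomial A \<beta>) (tree_monomial A (Node {#\<beta>#}))"
proof -
  obtain n where n: "tree_order \<beta> = Suc n"
    using tree_order_pos[of \<beta>] by (cases "tree_order \<beta>") auto
  have "tree_monomial A (Node {#\<beta>#}) None = (\<lambda>\<tau>. \<tau> ^ Suc n / real (tree_factorial \<beta>))"
    by (rule ext)
      (simp add: tree_monomial_def order_div_factorial n del: tree_factorial.simps tree_order.simps,
       simp add: n)
  moreover have "((\<lambda>\<tau>. \<tau> ^ Suc n / real (tree_factorial \<beta>)) has_real_derivative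
      tree_monomial A \<beta> None \<tau>) (at \<tau>)" for \<tau>
    using DERIV_cdivide[OF DERIV_pow[of "Suc n" \<tau>]]
    by (simp add: tree_monomial_def n mult.commute)
  ultimately have "(tree_monomial A (Node {#\<beta>#}) None has_real_derivative
      tree_monomial A \<beta> None \<tau>) (at \<tau>)" for \<tau>
    by simp
  moreover have "tree_monomial A (Node {#\<beta>#}) (Some i) \<tau> =
      \<tau> * (\<Sum>j\<in>UNIV. A $ i $ j * tree_monomial A \<beta> (Some j) \<tau>)" for i \<tau>
    by (simp add: tree_monomial_def n matrix_vector_mult_def sum_distrib_left mult_ac)
  moreover have "tree_monomial A (Node {#\<beta>#}) None 0 = 0"
    by (simp add: tree_monomial_def n)
  ultimately show ?thesis by (simp add: rk_lift_def)
qed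

lemma rk_lift_add:
  assumes "rk_lift A F H" "rk_lift A F' H'"
  shows "rk_lift A (\<lambda>i \<tau>. F i \<tau> + F' i \<tau>) (\<lambda>i \<tau>. H i \<tau> + H' i \<tau>)"
  using assms unfolding rk_lift_def
  by (auto elim: eventually_elim2 intro: DERIV_add simp: distrib_left sum.distrib)

lemma rk_lift_scale:
  assumes "rk_lift A F H"
  shows "rk_lift A (\<lambda>i \<tau>. c * F i \<tau>) (\<lambda>i \<tau>. c * H i \<tau>)"
  using assms unfolding rk_lift_def
  by (auto elim!: eventually_mono intro: DERIV_cmult simp: sum_distrib_left mult_ac)

lemma rk_lift_diff:
  assumes "rk_lift A F H" "rk_lift A F' H'"
  shows "rk_lift A (\<lambda>i \<tau>. F i \<tau> - F' i \<tau>) (\<lambda>i \<tau>. H i \<tau> - H' i \<tau>)"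
  using rk_lift_add[OF assms(1) rk_lift_scale[OF assms(2), of "-1"]] by simp

lemma bigo_cmult:
  fixes f :: "real \<Rightarrow> real"
  shows "f \<in> O[F](g) \<Longrightarrow> (\<lambda>x. c * f x) \<in> O[F](g)"
  by (cases "c = 0") simp_all

text \<open>For the monomial of \<open>\<beta>\<close> the quadrature defect is a constant times
  \<open>\<tau> ^ tree_order \<beta>\<close>. The constant vanishes by the order conditions if the
  order is at most \<open>p\<close>; otherwise the exponent is at least \<open>p + 1\<close>. The
  general case follows by linearity.\<close>

lemma tree_sum_lift:
  assumes "tree_sum A F"
    and "\<And>\<beta>. tree_order \<beta> \<le> p \<Longrightarrow> b \<bullet> rk_weights A \<beta> = 1 / real (tree_factorial \<beta>)"
  obtains H where "tree_sum A H" "rk_lift A F H"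
    "(\<lambda>\<tau>. H None \<tau> - \<tau> * (\<Sum>j\<in>UNIV. b $ j * F (Some j) \<tau>)) \<in> O[at 0](\<lambda>\<tau>. \<tau> ^ (p + 1))"
proof -
  have "\<exists>H. tree_sum A H \<and> rk_lift A F H \<and>
    (\<lambda>\<tau>. H None \<tau> - \<tau> * (\<Sum>j\<in>UNIV. b $ j * F (Some j) \<tau>)) \<in> O[at 0](\<lambda>\<tau>. \<tau> ^ (p + 1))"
    using assms(1)
  proof induction
    case (monomial \<beta>)
    obtain n where n: "tree_order \<beta> = Suc n"
      using tree_order_pos[of \<beta>] by (cases "tree_order \<beta>") auto
    let ?c = "1 / real (tree_factorial \<beta>) - b \<bullet> rk_weights A \<beta>"
    have eq: "(\<lambda>\<tau>. tree_monomial A (Node {#\<beta>#}) None \<tau>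
        - \<tau> * (\<Sum>j\<in>UNIV. b $ j * tree_monomial A \<beta> (Some j) \<tau>)) = (\<lambda>\<tau>. ?c * \<tau> ^ Suc n)"
      by (simp add: tree_monomial_def order_div_factorial n del: tree_factorial.simps tree_order.simps)
        (simp add: n inner_vec_def sum_distrib_left algebra_simps)
    have "(\<lambda>\<tau>::real. ?c * \<tau> ^ Suc n) \<in> O[at 0](\<lambda>\<tau>. \<tau> ^ (p + 1))"
    proof (cases "tree_order \<beta> \<le> p")
      case True
      then show ?thesis using assms(2) by simp
    next
      case False
      then obtain m where "n = p + m" using n by (auto simp: not_le less_Suc_eq_le dest: le_Suc_ex)
      then have "(\<lambda>\<tau>::real. ?c * \<tau> ^ Suc n) = (\<lambda>\<tau>. (?c * \<tau> ^ m) * \<tau> ^ (p + 1))"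
        by (simp add: power_add mult_ac)
      moreover have "(\<lambda>\<tau>. ?c * \<tau> ^ m) \<in> O[at 0](\<lambda>_. 1)"
        by (intro bigoI_tendsto[where c = "?c * 0 ^ m"] tendsto_intros)
          (auto intro!: tendsto_eq_intros)
      ultimately show ?thesis
        using landau_o.big.mult[of "\<lambda>\<tau>. ?c * \<tau> ^ m" "at 0" "\<lambda>_. 1"
            "\<lambda>\<tau>. \<tau> ^ (p + 1)" "\<lambda>\<tau>. \<tau> ^ (p + 1)"] by simp
    qed
    then show ?case
      by (intro exI[of _ "tree_monomial A (Node {#\<beta>#})"])
        (simp only: eq tree_sum.monomial rk_lift_monomial simp_thms)
  next
    case (add F F')
    then obtain H H' where H: "tree_sum A H" "rk_lift A F H" "tree_sum A H'" "rk_lift A F' H'"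
      "(\<lambda>\<tau>. H None \<tau> - \<tau> * (\<Sum>j\<in>UNIV. b $ j * F (Some j) \<tau>)) \<in> O[at 0](\<lambda>\<tau>. \<tau> ^ (p + 1))"
      "(\<lambda>\<tau>. H' None \<tau> - \<tau> * (\<Sum>j\<in>UNIV. b $ j * F' (Some j) \<tau>)) \<in> O[at 0](\<lambda>\<tau>. \<tau> ^ (p + 1))"
      by blast
    show ?case
      using tree_sum.add[OF H(1,3)] rk_lift_add[OF H(2,4)] sum_in_bigo(1)[OF H(5,6)]
      by (intro exI[of _ "\<lambda>i \<tau>. H i \<tau> + H' i \<tau>"]) (simp add: algebra_simps sum.distrib)
  next
    case (scale F c)
    then obtain H where H: "tree_sum A H" "rk_lift A F H"
      "(\<lambda>\<tau>. H None \<tau> - \<tau> * (\<Sum>j\<in>UNIV. b $ j * F (Some j) \<tau>)) \<in> O[at 0](\<lambda>\<tau>. \<tau> ^ (p + 1))"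
      by blast
    have "(\<lambda>\<tau>. c * (H None \<tau> - \<tau> * (\<Sum>j\<in>UNIV. b $ j * F (Some j) \<tau>))) \<in> O[at 0](\<lambda>\<tau>. \<tau> ^ (p + 1))"
      using H(3) by (rule bigo_cmult)
    then show ?case
      using tree_sum.scale[OF H(1)] rk_lift_scale[OF H(2)]
      by (intro exI[of _ "\<lambda>i \<tau>. c * H i \<tau>"]) (simp add: algebra_simps sum_distrib_left)
  qed
  then show thesis using that by blast
qed

section \<open>Gain of one power of \<open>\<tau>\<close> under J\<close>

text \<open>A mean value inequality with the derivative bounded on the open interval only: in
  \<open>rk_lift_bigo\<close> the left end is the point 0, about which an estimate in
  \<open>at 0\<close> says nothing.\<close>

lemma norm_diff_bound_unit_interval:
  fixes g :: "real \<Rightarrow> 'a::real_inner"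
  assumes "\<And>t. 0 \<le> t \<Longrightarrow> t \<le> 1 \<Longrightarrow> (g has_vector_derivative g' t) (at t)"
    and "\<And>t. 0 < t \<Longrightarrow> t < 1 \<Longrightarrow> norm (g' t) \<le> B"
  shows "norm (g 1 - g 0) \<le> B"
proof -
  have "continuous_on {0..1} g"
    using assms(1) by (auto intro!: continuous_at_imp_continuous_on has_vector_derivative_continuous)
  then obtain t where "0 < t" "t < 1" "norm (g 1 - g 0) \<le> norm ((1 - 0) *\<^sub>R g' t)"
    using mvt_general[of 0 1 g "\<lambda>t s. s *\<^sub>R g' t"] assms(1)
    by (auto simp: has_vector_derivative_def)
  then show ?thesis using assms(2)[of t] by simp
qed

lemma rk_lift_bigo:
  assumes "rk_lift A F H" and F: "\<And>i. F i \<in> O[at 0](\<lambda>\<tau>. \<tau> ^ q)"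
  shows "H i \<in> O[at 0](\<lambda>\<tau>. \<tau> ^ Suc q)"
proof (cases i)
  case None
  obtain C where "C > 0" and C: "\<forall>\<^sub>F \<tau> in at 0. norm (F None \<tau>) \<le> C * norm (\<tau> ^ q)"
    using landau_o.bigE[OF F] by blast
  obtain \<delta> where "\<delta> > 0" and \<delta>: "\<And>\<tau>. \<tau> \<noteq> 0 \<Longrightarrow> \<bar>\<tau>\<bar> < \<delta> \<Longrightarrow> \<bar>F None \<tau>\<bar> \<le> C * \<bar>\<tau>\<bar> ^ q"
    using C by (auto simp: eventually_at power_abs)
  obtain \<epsilon> where "\<epsilon> > 0" and \<epsilon>: "\<And>\<tau>. \<bar>\<tau>\<bar> < \<epsilon> \<Longrightarrow> (H None has_real_derivative F None \<tau>) (at \<tau>)"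
    using assms(1) unfolding rk_lift_def eventually_nhds_metric by auto
  have "\<bar>H None \<tau>\<bar> \<le> C * \<bar>\<tau> ^ Suc q\<bar>" if \<tau>: "\<tau> \<noteq> 0" "\<bar>\<tau>\<bar> < min \<delta> \<epsilon>" for \<tau>
  proof -
    have le: "\<bar>t * \<tau>\<bar> \<le> \<bar>\<tau>\<bar>" if "0 \<le> t" "t \<le> 1" for t
      using that by (simp add: abs_mult mult_left_le_one_le)
    \<comment> \<open>Scaling by \<open>t\<close> in the unit interval treats both signs of
      \<open>\<tau>\<close> alike, and the chain rule supplies the extra factor
      \<open>\<tau>\<close>.\<close>
    have "norm (H None (1 * \<tau>) - H None (0 * \<tau>)) \<le> C * \<bar>\<tau> ^ Suc q\<bar>"
    proof (rule norm_diff_bound_unit_interval)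
      fix t :: real assume t: "0 \<le> t" "t \<le> 1"
      then have "(H None has_real_derivative F None (t * \<tau>)) (at (t * \<tau>))"
        using \<epsilon> le[OF t] \<tau> by simp
      then have "((\<lambda>t. H None (t * \<tau>)) has_real_derivative F None (t * \<tau>) * \<tau>) (at t)"
        by (rule DERIV_chain2) (auto intro!: derivative_eq_intros)
      then show "((\<lambda>t. H None (t * \<tau>)) has_vector_derivative F None (t * \<tau>) * \<tau>) (at t)"
        by (simp add: has_real_derivative_iff_has_vector_derivative)
    next
      fix t :: real assume t: "0 < t" "t < 1"
      then have "\<bar>F None (t * \<tau>)\<bar> \<le> C * \<bar>t * \<tau>\<bar> ^ q"
        using le[of t] \<tau> by (intro \<delta>) auto
      also have "\<dots> \<le> C * \<bar>\<tau>\<bar> ^ q"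
        using le[of t] t \<open>C > 0\<close> by (intro mult_left_mono power_mono) auto
      finally show "norm (F None (t * \<tau>) * \<tau>) \<le> C * \<bar>\<tau> ^ Suc q\<bar>"
        using mult_right_mono[of "\<bar>F None (t * \<tau>)\<bar>" "C * \<bar>\<tau>\<bar> ^ q" "\<bar>\<tau>\<bar>"]
        by (simp add: abs_mult power_abs mult_ac)
    qed
    then show ?thesis using assms(1) by (simp add: rk_lift_def)
  qed
  then have "\<forall>\<^sub>F \<tau> in at 0. norm (H None \<tau>) \<le> C * norm (\<tau> ^ Suc q)"
    unfolding eventually_at using \<open>\<delta> > 0\<close> \<open>\<epsilon> > 0\<close> by (intro exI[of _ "min \<delta> \<epsilon>"]) auto
  then show ?thesis using None landau_o.bigI[OF \<open>C > 0\<close>] by auto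
next
  case (Some l)
  have "(\<lambda>\<tau>. \<tau> * (\<Sum>j\<in>UNIV. A $ l $ j * F (Some j) \<tau>)) \<in> O[at 0](\<lambda>\<tau>. \<tau> * \<tau> ^ q)"
    by (intro landau_o.big.mult landau_o.big_refl big_sum_in_bigo bigo_cmult F)
  moreover have "\<forall>\<^sub>F \<tau> in at 0. H (Some l) \<tau> = \<tau> * (\<Sum>j\<in>UNIV. A $ l $ j * F (Some j) \<tau>)"
    using assms(1) unfolding rk_lift_def by (auto elim: eventually_mono)
  ultimately show ?thesis
    using Some by (simp add: landau_o.big.in_cong)
qed

section \<open>Expansions in the span up to a power of \<open>\<tau>\<close>\<close>

text \<open>One \<open>G\<close> must serve for all \<open>i\<close>: this is what ties the stages
  to the exact slope.\<close>

definition tree_expansion :: "real ^ 's ^ 's \<Rightarrow> nat \<Rightarrow> ('s option \<Rightarrow> real \<Rightarrow> real) \<Rightarrow> bool" where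
  "tree_expansion A q F \<longleftrightarrow>
     (\<exists>G. tree_sum A G \<and> (\<forall>i. (\<lambda>\<tau>. F i \<tau> - G i \<tau>) \<in> O[at 0](\<lambda>\<tau>. \<tau> ^ q)))"

lemma tree_expansion_const: "tree_expansion A q (\<lambda>i \<tau>. c)"
  unfolding tree_expansion_def using tree_sum_const[of A c] by (intro exI[of _ "\<lambda>i \<tau>. c"]) simp

lemma tree_expansion_add:
  assumes "tree_expansion A q F" "tree_expansion A q F'"
  shows "tree_expansion A q (\<lambda>i \<tau>. F i \<tau> + F' i \<tau>)"
proof -
  from assms obtain G G' where G: "tree_sum A G" "tree_sum A G'"
    "\<And>i. (\<lambda>\<tau>. F i \<tau> - G i \<tau>) \<in> O[at 0](\<lambda>\<tau>. \<tau> ^ q)"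
    "\<And>i. (\<lambda>\<tau>. F' i \<tau> - G' i \<tau>) \<in> O[at 0](\<lambda>\<tau>. \<tau> ^ q)"
    unfolding tree_expansion_def by blast
  show ?thesis
    unfolding tree_expansion_def
    using tree_sum.add[OF G(1,2)] sum_in_bigo(1)[OF G(3,4)]
    by (intro exI[of _ "\<lambda>i \<tau>. G i \<tau> + G' i \<tau>"]) (simp add: algebra_simps)
qed

lemma power_bigo_1_at_0: "(\<lambda>\<tau>::real. \<tau> ^ q) \<in> O[at 0](\<lambda>_. 1)"
  by (intro bigoI_tendsto[where c = "0 ^ q"]) (auto intro!: tendsto_eq_intros)

text \<open>The error of the product is \<open>(F - G) * F' + (F' - G') * G\<close>. Here
  \<open>F'\<close> is bounded because it differs from the bounded \<open>G'\<close> by a bounded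
  error.\<close>

lemma tree_expansion_mult:
  assumes "tree_expansion A q F" "tree_expansion A q F'"
  shows "tree_expansion A q (\<lambda>i \<tau>. F i \<tau> * F' i \<tau>)"
proof -
  from assms obtain G G' where G: "tree_sum A G" "tree_sum A G'"
    "\<And>i. (\<lambda>\<tau>. F i \<tau> - G i \<tau>) \<in> O[at 0](\<lambda>\<tau>. \<tau> ^ q)"
    "\<And>i. (\<lambda>\<tau>. F' i \<tau> - G' i \<tau>) \<in> O[at 0](\<lambda>\<tau>. \<tau> ^ q)"
    unfolding tree_expansion_def by blast
  have "(\<lambda>\<tau>. F i \<tau> * F' i \<tau> - G i \<tau> * G' i \<tau>) \<in> O[at 0](\<lambda>\<tau>. \<tau> ^ q)" for i
  proof -
    have "(\<lambda>\<tau>. (F' i \<tau> - G' i \<tau>) + G' i \<tau>) \<in> O[at 0](\<lambda>_. 1)"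
      by (rule sum_in_bigo(1)[OF landau_o.big_trans[OF G(4) power_bigo_1_at_0] tree_sum_bounded[OF G(2)]])
    then have F': "F' i \<in> O[at 0](\<lambda>_. 1)"
      by simp
    have "(\<lambda>\<tau>. (F i \<tau> - G i \<tau>) * F' i \<tau> + (F' i \<tau> - G' i \<tau>) * G i \<tau>)
        \<in> O[at 0](\<lambda>\<tau>. \<tau> ^ q * 1)"
      by (rule sum_in_bigo(1)[OF landau_o.big.mult[OF G(3) F']
            landau_o.big.mult[OF G(4) tree_sum_bounded[OF G(1)]]])
    then show ?thesis by (simp add: algebra_simps)
  qed
  then show ?thesis
    unfolding tree_expansion_def using tree_sum_mult[OF G(1,2)] by blast
qed

lemma tree_expansion_sum:
  assumes "finite I" "\<And>c. c \<in> I \<Longrightarrow> tree_expansion A q (F c)"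
  shows "tree_expansion A q (\<lambda>i \<tau>. \<Sum>c\<in>I. F c i \<tau>)"
  using assms
  by (induction I) (auto intro: tree_expansion_const tree_expansion_add)

text \<open>Polynomials arise from constants and linear forms by sums and products, under which
  expansions are closed. A linear form combines the coordinates, with its values at the unit vectors
  as coefficients.\<close>

lemma tree_expansion_polynomial:
  fixes H :: "'s::finite option \<Rightarrow> real \<Rightarrow> real ^ 'd" and P :: "real ^ 'd \<Rightarrow> real"
  assumes "real_polynomial_function P" and H: "\<And>c. tree_expansion A q (\<lambda>i \<tau>. H i \<tau> $ c)"
  shows "tree_expansion A q (\<lambda>i \<tau>. P (H i \<tau>))"
  using assms(1)
proof induction
  case (linear P)
  then interpret bounded_linear P .
  have "P h = (\<Sum>c\<in>UNIV. P (axis c 1) * h $ c)" for h :: "real ^ 'd"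
    using sum[of "\<lambda>c. h $ c *\<^sub>R axis c 1" UNIV] basis_expansion[of h]
    by (simp add: scaleR scalar_mult_eq_scaleR mult.commute)
  then have "(\<lambda>i \<tau>. P (H i \<tau>)) = (\<lambda>i \<tau>. \<Sum>c\<in>UNIV. P (axis c 1) * H i \<tau> $ c)"
    by blast
  moreover have "tree_expansion A q (\<lambda>i \<tau>. \<Sum>c\<in>UNIV. P (axis c 1) * H i \<tau> $ c)"
    by (rule tree_expansion_sum[OF finite tree_expansion_mult[OF tree_expansion_const H]])
  ultimately show ?case by (rule ssubst[where P = "tree_expansion A q"])
qed (rule tree_expansion_const tree_expansion_add tree_expansion_mult; assumption)+

lemma tree_expansion_lift:
  assumes "tree_expansion A q F" "rk_lift A F H"
  shows "tree_expansion A (Suc q) H"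
proof -
  obtain G where G: "tree_sum A G" "\<And>i. (\<lambda>\<tau>. F i \<tau> - G i \<tau>) \<in> O[at 0](\<lambda>\<tau>. \<tau> ^ q)"
    using assms(1) unfolding tree_expansion_def by blast
  \<comment> \<open>With \<open>p = 0\<close> and \<open>b = 0\<close> the order conditions are
    vacuous, as every tree has positive order; this extracts the bare lift inside the span.\<close>
  have "0 \<bullet> rk_weights A \<beta> = 1 / real (tree_factorial \<beta>)" if "tree_order \<beta> \<le> 0" for \<beta>
    using that tree_order_pos[of \<beta>] by simp
  from tree_sum_lift[OF G(1) this] obtain H' where H': "tree_sum A H'" "rk_lift A G H'"
    by blast
  show ?thesis
    unfolding tree_expansion_def
    using H'(1) rk_lift_bigo[OF rk_lift_diff[OF assms(2) H'(2)] G(2)] by blast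
qed

lemma tree_expansion_approx:
  assumes "tree_expansion A q F" "\<And>i. (\<lambda>\<tau>. F' i \<tau> - F i \<tau>) \<in> O[at 0](\<lambda>\<tau>. \<tau> ^ q)"
  shows "tree_expansion A q F'"
proof -
  obtain G where G: "tree_sum A G" "\<And>i. (\<lambda>\<tau>. F i \<tau> - G i \<tau>) \<in> O[at 0](\<lambda>\<tau>. \<tau> ^ q)"
    using assms(1) unfolding tree_expansion_def by blast
  have "(\<lambda>\<tau>. F' i \<tau> - G i \<tau>) \<in> O[at 0](\<lambda>\<tau>. \<tau> ^ q)" for i
    using sum_in_bigo(1)[OF assms(2)[of i] G(2)[of i]] by simp
  with G(1) show ?thesis unfolding tree_expansion_def by blast
qed

section \<open>Taylor expansion for the class \<open>C_on\<close>\<close>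

text \<open>Induction on \<open>q\<close> through the expansions of all directional derivatives.
  Homogeneity of the \<open>P n\<close> is carried along because on a segment it leaves explicit
  powers of \<open>t\<close>, which are differentiated termwise.\<close>

lemma C_on_taylor:
  fixes g :: "'a::euclidean_space \<Rightarrow> 'b::euclidean_space"
  assumes "open S" "C_on q S g" "x \<in> S"
  shows "\<exists>P C \<delta>. (\<forall>n. polynomial_function (P n) \<and> (\<forall>t h. P n (t *\<^sub>R h) = t ^ n *\<^sub>R P n h)) \<and> \<delta> > 0 \<and>
    (\<forall>h. norm h < \<delta> \<longrightarrow> norm (g (x + h) - (\<Sum>n<q. P n h)) \<le> C * norm h ^ q)"
  using assms(2)
proof (induction q arbitrary: g)
  case 0
  then have "isCont g x"
    using assms continuous_on_eq_continuous_at by auto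
  then obtain \<delta> where "\<delta> > 0" and \<delta>: "\<And>y. dist y x < \<delta> \<Longrightarrow> dist (g y) (g x) < 1"
    unfolding continuous_at_eps_delta by (meson zero_less_one)
  \<comment> \<open>For \<open>q = 0\<close> the sum is empty and the claim is local
    boundedness.\<close>
  have "norm (g (x + h)) \<le> norm (g x) + 1" if "norm h < \<delta>" for h
    using \<delta>[of "x + h"] that norm_triangle_ineq2[of "g (x + h)" "g x"] by (auto simp: dist_norm)
  with \<open>\<delta> > 0\<close> show ?case
    by (intro exI[of _ "\<lambda>_ _. 0"] exI[of _ "norm (g x) + 1"] exI[of _ \<delta>]) auto
next
  case (Suc q)
  let ?d = "\<lambda>v y. frechet_derivative g (at y) v"
  have "\<forall>v. \<exists>P C \<delta>. (\<forall>n. polynomial_function (P n) \<and> (\<forall>t h. P n (t *\<^sub>R h) = t ^ n *\<^sub>R P n h)) \<and> \<delta> > 0 \<and>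
    (\<forall>h. norm h < \<delta> \<longrightarrow> norm (?d v (x + h) - (\<Sum>n<q. P n h)) \<le> C * norm h ^ q)"
    using Suc.prems by (intro allI Suc.IH) simp
  then obtain P C \<delta> where P: "\<And>v n. polynomial_function (P v n)"
      "\<And>v n t h. P v n (t *\<^sub>R h) = t ^ n *\<^sub>R P v n h" and \<delta>: "\<And>v. \<delta> v > 0" and
      C: "\<And>v h. norm h < \<delta> v \<Longrightarrow> norm (?d v (x + h) - (\<Sum>n<q. P v n h)) \<le> C v * norm h ^ q"
    by metis
  \<comment> \<open>integrate the expansion of the derivative along the segment from \<open>x\<close> to \<open>x + h\<close>\<close>
  define Q where "Q n h = (case n of 0 \<Rightarrow> g x
    | Suc m \<Rightarrow> (1 / real (Suc m)) *\<^sub>R (\<Sum>v\<in>Basis. (h \<bullet> v) *\<^sub>R P v m h))" for n h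
  have "polynomial_function (Q n)" for n
    unfolding Q_def
    by (cases n) (auto intro!: polynomial_function_cmul polynomial_function_sum polynomial_function_mult P
       simp: polynomial_function_bounded_linear bounded_linear_inner_left)
  moreover have "Q n (t *\<^sub>R h) = t ^ n *\<^sub>R Q n h" for n t h
    by (cases n) (simp_all add: Q_def P scaleR_sum_right mult_ac)
  moreover obtain r where "r > 0" and r: "ball x r \<subseteq> S"
    using assms openE by blast
  define \<epsilon> where "\<epsilon> = Min (insert r (\<delta> ` Basis))"
  have "\<epsilon> > 0" "\<epsilon> \<le> r" "\<And>v. v \<in> Basis \<Longrightarrow> \<epsilon> \<le> \<delta> v"
    using \<open>r > 0\<close> \<delta> by (auto simp: \<epsilon>_def min_le_iff_disj)
  moreover have "norm (g (x + h) - (\<Sum>n<Suc q. Q n h)) \<le> (\<Sum>v\<in>Basis. \<bar>C v\<bar>) * norm h ^ Suc q"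
    if h: "norm h < \<epsilon>" for h
  proof -
    have le: "norm (t *\<^sub>R h) \<le> norm h" if "0 \<le> t" "t \<le> 1" for t
      using that by (simp add: mult_left_le_one_le)
    \<comment> \<open>\<open>D\<close> is the derivative of the remainder \<open>w\<close> along the
      segment: the remainders of the directional derivatives weighted by the coordinates of
      \<open>h\<close>. The weights supply one factor \<open>norm h\<close>, the induction
      hypothesis the other \<open>q\<close>.\<close>
    define D where "D t = (\<Sum>v\<in>Basis. (h \<bullet> v) *\<^sub>R (?d v (x + t *\<^sub>R h) - (\<Sum>n<q. P v n (t *\<^sub>R h))))" for t
    define w where "w t = g (x + t *\<^sub>R h) - (\<Sum>n<Suc q. t ^ n *\<^sub>R Q n h)" for t
    have "norm (w 1 - w 0) \<le> (\<Sum>v\<in>Basis. \<bar>C v\<bar>) * norm h ^ Suc q"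
    proof (rule norm_diff_bound_unit_interval)
      fix t :: real assume t: "0 \<le> t" "t \<le> 1"
      have "x + t *\<^sub>R h \<in> S"
        using r le[OF t] h \<open>\<epsilon> \<le> r\<close> by (auto simp: dist_norm subset_iff)
      then have g': "(g has_derivative (\<lambda>v. ?d v (x + t *\<^sub>R h))) (at (x + t *\<^sub>R h))"
        using Suc.prems by (simp add: frechet_derivative_works[symmetric])
      then have lin: "linear (\<lambda>v. ?d v (x + t *\<^sub>R h))"
        by (rule has_derivative_linear)
      have "((\<lambda>t. x + t *\<^sub>R h) has_vector_derivative h) (at t)"
        by (auto intro!: derivative_eq_intros)
      from vector_derivative_diff_chain_within[OF this has_derivative_at_withinI[OF g']]
      have g: "((\<lambda>t. g (x + t *\<^sub>R h)) has_vector_derivative ?d h (x + t *\<^sub>R h)) (at t)"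
        by (simp add: o_def)
      have "?d h (x + t *\<^sub>R h) = (\<Sum>v\<in>Basis. (h \<bullet> v) *\<^sub>R ?d v (x + t *\<^sub>R h))"
        using linear_sum[OF lin, of "\<lambda>v. (h \<bullet> v) *\<^sub>R v" Basis] linear_cmul[OF lin]
        by (simp add: euclidean_representation)
      moreover have "((\<lambda>t. \<Sum>n<Suc q. t ^ n *\<^sub>R Q n h) has_vector_derivative
          (\<Sum>v\<in>Basis. (h \<bullet> v) *\<^sub>R (\<Sum>n<q. P v n (t *\<^sub>R h)))) (at t)"
      proof -
        have "((\<lambda>t. \<Sum>n<Suc q. t ^ n *\<^sub>R Q n h) has_vector_derivative
            (\<Sum>n<Suc q. (real n * t ^ (n - 1)) *\<^sub>R Q n h)) (at t)"
          by (intro has_vector_derivative_sum) (auto intro!: derivative_eq_intros)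
        \<comment> \<open>The constant term drops out, the factor \<open>real (Suc n)\<close>
          cancels against the one in \<open>Q\<close>, and homogeneity moves \<open>t ^ n\<close>
          into the argument of \<open>P v n\<close>.\<close>
        also have "(\<Sum>n<Suc q. (real n * t ^ (n - 1)) *\<^sub>R Q n h)
            = (\<Sum>n<q. \<Sum>v\<in>Basis. (h \<bullet> v) *\<^sub>R P v n (t *\<^sub>R h))"
          unfolding sum.lessThan_Suc_shift
          by (simp add: Q_def P scaleR_sum_right mult_ac del: of_nat_Suc)
        also have "\<dots> = (\<Sum>v\<in>Basis. (h \<bullet> v) *\<^sub>R (\<Sum>n<q. P v n (t *\<^sub>R h)))"
          by (subst sum.swap) (simp add: scaleR_sum_right)
        finally show ?thesis .
      qed
      ultimately show "(w has_vector_derivative D t) (at t)"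
        using has_vector_derivative_diff[OF g]
        by (simp add: w_def[abs_def] D_def scaleR_diff_right sum_subtractf)
    next
      fix t :: real assume t: "0 < t" "t < 1"
      have "norm (D t) \<le> (\<Sum>v\<in>Basis. \<bar>C v\<bar> * norm h ^ Suc q)"
        unfolding D_def
      proof (intro sum_norm_le)
        fix v :: 'a assume v: "v \<in> Basis"
        have "norm (?d v (x + t *\<^sub>R h) - (\<Sum>n<q. P v n (t *\<^sub>R h))) \<le> C v * norm (t *\<^sub>R h) ^ q"
          using le[of t] t h \<open>\<And>v. v \<in> Basis \<Longrightarrow> \<epsilon> \<le> \<delta> v\<close>[OF v] by (intro C) simp
        also have "\<dots> \<le> \<bar>C v\<bar> * norm h ^ q"
          using le[of t] t by (intro mult_mono power_mono) auto
        finally have "norm (?d v (x + t *\<^sub>R h) - (\<Sum>n<q. P v n (t *\<^sub>R h))) \<le> \<bar>C v\<bar> * norm h ^ q" .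
        then have "\<bar>h \<bullet> v\<bar> * norm (?d v (x + t *\<^sub>R h) - (\<Sum>n<q. P v n (t *\<^sub>R h)))
            \<le> norm h * (\<bar>C v\<bar> * norm h ^ q)"
          using Basis_le_norm[OF v, of h] by (intro mult_mono) auto
        then show "norm ((h \<bullet> v) *\<^sub>R (?d v (x + t *\<^sub>R h) - (\<Sum>n<q. P v n (t *\<^sub>R h))))
            \<le> \<bar>C v\<bar> * norm h ^ Suc q"
          by (simp add: mult_ac)
      qed
      then show "norm (D t) \<le> (\<Sum>v\<in>Basis. \<bar>C v\<bar>) * norm h ^ Suc q"
        by (simp add: sum_distrib_right)
    qed
    moreover have "w 0 = 0"
      unfolding w_def sum.lessThan_Suc_shift by (simp add: Q_def)
    ultimately show ?thesis by (simp add: w_def)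
  qed
  ultimately show ?case by blast
qed

lemma C_on_Suc_imp: "C_on (Suc k) S f \<Longrightarrow> C_on k S f"
proof (induction k arbitrary: f)
  case 0
  then show ?case
    by (auto intro!: continuous_at_imp_continuous_on differentiable_imp_continuous_within)
qed auto

lemma C_on_mono:
  assumes "C_on k S f" "j \<le> k"
  shows "C_on j S f"
  using assms(2,1) by (induction rule: inc_induct) (blast dest: C_on_Suc_imp)+

section \<open>The common expansion of exact slope and stages\<close>

text \<open>An expansion of \<open>K\<close> to the power \<open>q\<close> gives one of
  \<open>H\<close> to the power \<open>q + 1\<close>, which passes to the Taylor polynomial of
  \<open>f\<close> of degree at most \<open>q\<close>. This round uses class \<open>q + 1\<close>,
  so class \<open>p\<close> allows \<open>p\<close> rounds.\<close>

lemma tree_expansion_fixed_point: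
  fixes f :: "real ^ 'd \<Rightarrow> real ^ 'd" and H :: "'s::finite option \<Rightarrow> real \<Rightarrow> real ^ 'd"
  assumes "open S" "x \<in> S" "C_on p S f"
    and lift: "\<And>c. rk_lift A (K c) (\<lambda>i \<tau>. H i \<tau> $ c)"
    and bdd: "\<And>c i. K c i \<in> O[at 0](\<lambda>_. 1)"
    and fp: "\<And>c i. \<forall>\<^sub>F \<tau> in at 0. K c i \<tau> = f (x + H i \<tau>) $ c"
    and "q \<le> p"
  shows "tree_expansion A q (K c)"
  using \<open>q \<le> p\<close>
proof (induction q arbitrary: c)
  case 0
  \<comment> \<open>To order 0 the zero sum is an expansion of the bounded \<open>K\<close>.\<close>
  show ?case
    unfolding tree_expansion_def using bdd tree_sum_const[of A 0]
    by (intro exI[of _ "\<lambda>i \<tau>. 0"]) simp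
next
  case (Suc q)
  \<comment> \<open>The lift of the bounded \<open>K\<close> is \<open>O(\<tau>)\<close>; this
    brings \<open>H\<close> into the ball of the Taylor estimate and turns the remainder into a
    power of \<open>\<tau>\<close>.\<close>
  have HO: "(\<lambda>\<tau>. H i \<tau> $ c) \<in> O[at 0](\<lambda>\<tau>. \<tau>)" for i c
    using rk_lift_bigo[OF lift, of c 0 i] bdd by simp
  have normH: "(\<lambda>\<tau>. norm (H i \<tau>)) \<in> O[at 0](\<lambda>\<tau>. \<tau>)" for i
  proof -
    have "(\<lambda>\<tau>. \<Sum>c\<in>UNIV. \<bar>H i \<tau> $ c\<bar>) \<in> O[at 0](\<lambda>\<tau>. \<tau>)"
      by (intro big_sum_in_bigo) (simp add: HO)
    moreover have "(\<lambda>\<tau>. norm (H i \<tau>)) \<in> O[at 0](\<lambda>\<tau>. \<Sum>c\<in>UNIV. \<bar>H i \<tau> $ c\<bar>)"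
      by (intro landau_o.big_mono always_eventually allI)
        (simp add: norm_le_l1_cart order_trans[OF norm_le_l1_cart])
    ultimately show ?thesis by (rule landau_o.big_trans[rotated])
  qed
  have H0: "((\<lambda>\<tau>. norm (H i \<tau>)) \<longlongrightarrow> 0) (at 0)" for i
  proof -
    obtain C where "\<forall>\<^sub>F \<tau> in at 0. norm (norm (H i \<tau>)) \<le> C * norm \<tau>"
      using landau_o.bigE[OF normH] by blast
    then show ?thesis
      by (rule Lim_null_comparison) (auto intro!: tendsto_eq_intros)
  qed
  obtain P C \<delta> where P: "\<And>n. polynomial_function (P n)" and "\<delta> > 0" and
    C: "\<And>h. norm h < \<delta> \<Longrightarrow> norm (f (x + h) - (\<Sum>n<Suc q. P n h)) \<le> C * norm h ^ Suc q"
    using C_on_taylor[OF assms(1) C_on_mono[OF assms(3) Suc.prems] assms(2)] by blast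
  define Q where "Q h = (\<Sum>n<Suc q. P n h) $ c" for h
  have "polynomial_function (\<lambda>h. \<Sum>n<Suc q. P n h)"
    using P by (intro polynomial_function_sum) auto
  then have "real_polynomial_function Q"
    unfolding polynomial_function_def Q_def[abs_def] using bounded_linear_vec_nth[of c]
    by (auto simp: o_def)
  moreover have "tree_expansion A (Suc q) (\<lambda>i \<tau>. H i \<tau> $ c)" for c
    using tree_expansion_lift[OF Suc.IH lift] Suc.prems by simp
  ultimately have "tree_expansion A (Suc q) (\<lambda>i \<tau>. Q (H i \<tau>))"
    by (rule tree_expansion_polynomial)
  then show ?case
  proof (rule tree_expansion_approx)
    fix i
    have "\<forall>\<^sub>F \<tau> in at 0. norm (H i \<tau>) < \<delta>"
      using order_tendstoD(2)[OF H0 \<open>\<delta> > 0\<close>] .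
    then have "\<forall>\<^sub>F \<tau> in at 0. norm (K c i \<tau> - Q (H i \<tau>)) \<le> C * norm (norm (H i \<tau>) ^ Suc q)"
      using fp[of c i]
    proof eventually_elim
      case (elim \<tau>)
      have "norm (K c i \<tau> - Q (H i \<tau>)) \<le> norm (f (x + H i \<tau>) - (\<Sum>n<Suc q. P n (H i \<tau>)))"
        using component_le_norm_cart[of "f (x + H i \<tau>) - (\<Sum>n<Suc q. P n (H i \<tau>))" c] elim
        by (simp add: Q_def)
      also have "\<dots> \<le> C * norm (norm (H i \<tau>) ^ Suc q)"
        using C[OF elim(1)] by simp
      finally show ?case .
    qed
    then have "(\<lambda>\<tau>. K c i \<tau> - Q (H i \<tau>)) \<in> O[at 0](\<lambda>\<tau>. norm (H i \<tau>) ^ Suc q)"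
      by (rule bigoI)
    also have "(\<lambda>\<tau>. norm (H i \<tau>) ^ Suc q) \<in> O[at 0](\<lambda>\<tau>. \<tau> ^ Suc q)"
      by (intro landau_o.big_power normH)
    finally show "(\<lambda>\<tau>. K c i \<tau> - Q (H i \<tau>)) \<in> O[at 0](\<lambda>\<tau>. \<tau> ^ Suc q)" .
  qed
qed

section \<open>Comparison of the exact and the discrete flow\<close>

theorem theorem3:
  fixes A :: "real ^ 's ^ 's" and b :: "real ^ 's" and p :: nat
    and \<Omega> :: "(real ^ 'd) set" and f :: "real ^ 'd \<Rightarrow> real ^ 'd" and x :: "real ^ 'd"
    and \<Phi> \<Psi> :: "real \<Rightarrow> real ^ 'd"
  assumes "p \<ge> 1"
    and "\<And>\<beta>. tree_order \<beta> \<le> p \<Longrightarrow> b \<bullet> rk_weights A \<beta> = 1 / real (tree_factorial \<beta>)"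
    and "open \<Omega>"
    and "C_on p \<Omega> f"
    and "x \<in> \<Omega>"
    and "is_flow \<Omega> f x \<Phi>"
    and "is_discrete_flow A b \<Omega> f x \<Psi>"
  shows "(\<lambda>\<tau>. norm (\<Phi> \<tau> - \<Psi> \<tau>)) \<in> O[at 0](\<lambda>\<tau>. \<tau> ^ (p + 1))"
proof -
  obtain k where k: "Bfun k (at 0)"
    and stages: "\<forall>\<^sub>F \<tau> in at 0. rk_stages A \<Omega> f x \<tau> (k \<tau>)"
    and \<Psi>: "\<forall>\<^sub>F \<tau> in at 0. \<Psi> \<tau> = x + \<tau> *\<^sub>R (\<Sum>i\<in>UNIV. b $ i *\<^sub>R k \<tau> $ i)"
    using assms(7) unfolding is_discrete_flow_def eventually_conj_iff by blast
  obtain \<epsilon> where "\<epsilon> > 0" and \<Phi>0: "\<Phi> 0 = x" and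
    \<Phi>: "\<And>\<tau>. \<bar>\<tau>\<bar> < \<epsilon> \<Longrightarrow> (\<Phi> has_vector_derivative f (\<Phi> \<tau>)) (at \<tau>)"
    using assms(6) unfolding is_flow_def by blast
  \<comment> \<open>Both problems in one family: slopes in \<open>K\<close>, increments of the
    argument of \<open>f\<close> in \<open>H\<close>. Subtracting \<open>x\<close> from the flow
    gives the primitive vanishing at 0 that \<open>rk_lift\<close> demands.\<close>
  define K where "K c i \<tau> = (case i of None \<Rightarrow> f (\<Phi> \<tau>) $ c | Some j \<Rightarrow> k \<tau> $ j $ c)" for c i \<tau>
  define H where "H i \<tau> = (case i of None \<Rightarrow> \<Phi> \<tau> - x
    | Some j \<Rightarrow> \<tau> *\<^sub>R (\<Sum>l\<in>UNIV. A $ j $ l *\<^sub>R k \<tau> $ l))" for i \<tau>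
  have lift: "rk_lift A (K c) (\<lambda>i \<tau>. H i \<tau> $ c)" for c
  proof -
    have "((\<lambda>\<tau>. (\<Phi> \<tau> - x) $ c) has_real_derivative f (\<Phi> \<tau>) $ c) (at \<tau>)" if "\<bar>\<tau>\<bar> < \<epsilon>" for \<tau>
      using bounded_linear.has_vector_derivative[OF bounded_linear_vec_nth[of c] \<Phi>[OF that]]
      by (auto simp: has_real_derivative_iff_has_vector_derivative intro!: derivative_eq_intros)
    then have "\<forall>\<^sub>F \<tau> in nhds 0. ((\<lambda>\<tau>. (\<Phi> \<tau> - x) $ c) has_real_derivative f (\<Phi> \<tau>) $ c) (at \<tau>)"
      unfolding eventually_nhds_metric using \<open>\<epsilon> > 0\<close> by auto
    then show ?thesis by (simp add: rk_lift_def K_def H_def \<Phi>0)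
  qed
  \<comment> \<open>For the exact slope this is continuity; for the stages it is the boundedness
    that selects the intended solution of the stage equations.\<close>
  have bdd: "K c i \<in> O[at 0](\<lambda>_. 1)" for c i
  proof (cases i)
    case None
    have "isCont f x"
      using C_on_mono[OF assms(4), of 0] assms(3,5) by (simp add: continuous_on_eq_continuous_at)
    moreover have "isCont \<Phi> 0"
      using \<Phi>[of 0] \<open>\<epsilon> > 0\<close> has_vector_derivative_continuous by auto
    ultimately have "isCont (\<lambda>\<tau>. f (\<Phi> \<tau>) $ c) 0"
      by (auto intro!: continuous_intros isCont_o2[of _ \<Phi>] simp: \<Phi>0)
    then show ?thesis
      using None unfolding isCont_def by (auto simp: K_def intro!: bigoI_tendsto)
  next
    case (Some j)
    obtain B where "\<forall>\<^sub>F \<tau> in at 0. norm (k \<tau>) \<le> B"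
      using k unfolding Bfun_def by blast
    then have "\<forall>\<^sub>F \<tau> in at 0. norm (K c i \<tau>) \<le> B * norm (1::real)"
    proof eventually_elim
      case (elim \<tau>)
      then show ?case
        using component_le_norm_cart[of "k \<tau> $ j" c] Finite_Cartesian_Product.norm_nth_le[of "k \<tau>" j] Some
        by (simp add: K_def)
    qed
    then show ?thesis by (rule bigoI)
  qed
  have fp: "\<forall>\<^sub>F \<tau> in at 0. K c i \<tau> = f (x + H i \<tau>) $ c" for c i
    using stages
  proof eventually_elim
    case (elim \<tau>)
    show ?case
    proof (cases i)
      case (Some j)
      have "k \<tau> $ j = f (x + H (Some j) \<tau>)"
        using elim unfolding rk_stages_def H_def option.case by blast
      then show ?thesis using Some by (simp add: K_def)
    qed (simp add: K_def H_def)
  qed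
  have main: "(\<lambda>\<tau>. (\<Phi> \<tau> - \<Psi> \<tau>) $ c) \<in> O[at 0](\<lambda>\<tau>. \<tau> ^ (p + 1))" for c
  proof -
    obtain G where G: "tree_sum A G"
      and KG: "\<And>i. (\<lambda>\<tau>. K c i \<tau> - G i \<tau>) \<in> O[at 0](\<lambda>\<tau>. \<tau> ^ p)"
      using tree_expansion_fixed_point[OF assms(3,5,4) lift bdd fp order_refl]
      unfolding tree_expansion_def by blast
    obtain L where L: "rk_lift A G L"
      "(\<lambda>\<tau>. L None \<tau> - \<tau> * (\<Sum>j\<in>UNIV. b $ j * G (Some j) \<tau>)) \<in> O[at 0](\<lambda>\<tau>. \<tau> ^ (p + 1))"
      using tree_sum_lift[OF G assms(2)] by blast
    \<comment> \<open>The error splits into the lift of \<open>K c - G\<close>, the quadrature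
      defect of \<open>G\<close> and, with a minus sign, the discrete quadrature of
      \<open>K c - G\<close>. The first and the last gain a power over the remainder
      \<open>O(\<tau> ^ p)\<close>; the order conditions control the second.\<close>
    have 1: "(\<lambda>\<tau>. H None \<tau> $ c - L None \<tau>) \<in> O[at 0](\<lambda>\<tau>. \<tau> ^ (p + 1))"
      using rk_lift_bigo[OF rk_lift_diff[OF lift L(1)] KG, of None] by simp
    have "(\<lambda>\<tau>. \<tau> * (\<Sum>j\<in>UNIV. b $ j * (K c (Some j) \<tau> - G (Some j) \<tau>)))
        \<in> O[at 0](\<lambda>\<tau>. \<tau> * \<tau> ^ p)"
      by (intro landau_o.big.mult landau_o.big_refl big_sum_in_bigo bigo_cmult KG)
    then have "(\<lambda>\<tau>. (H None \<tau> $ c - L None \<tau>)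
        + (L None \<tau> - \<tau> * (\<Sum>j\<in>UNIV. b $ j * G (Some j) \<tau>))
        - \<tau> * (\<Sum>j\<in>UNIV. b $ j * (K c (Some j) \<tau> - G (Some j) \<tau>))) \<in> O[at 0](\<lambda>\<tau>. \<tau> ^ (p + 1))"
      unfolding power_Suc[symmetric] Suc_eq_plus1
      by (rule sum_in_bigo(2)[OF sum_in_bigo(1)[OF 1 L(2)]])
    also have "?this \<longleftrightarrow> ?thesis"
    proof (rule landau_o.big.in_cong)
      show "\<forall>\<^sub>F \<tau> in at 0. (H None \<tau> $ c - L None \<tau>)
        + (L None \<tau> - \<tau> * (\<Sum>j\<in>UNIV. b $ j * G (Some j) \<tau>))
        - \<tau> * (\<Sum>j\<in>UNIV. b $ j * (K c (Some j) \<tau> - G (Some j) \<tau>)) = (\<Phi> \<tau> - \<Psi> \<tau>) $ c"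
        using \<Psi> by eventually_elim (simp add: H_def K_def right_diff_distrib sum_subtractf)
    qed
    finally show ?thesis .
  qed
  have "(\<lambda>\<tau>. norm (\<Phi> \<tau> - \<Psi> \<tau>)) \<in> O[at 0](\<lambda>\<tau>. \<Sum>c\<in>UNIV. \<bar>(\<Phi> \<tau> - \<Psi> \<tau>) $ c\<bar>)"
    by (intro landau_o.big_mono always_eventually allI)
      (simp only: real_norm_def abs_norm_cancel abs_of_nonneg[OF sum_nonneg] abs_ge_zero norm_le_l1_cart)
  also have "(\<lambda>\<tau>. \<Sum>c\<in>UNIV. \<bar>(\<Phi> \<tau> - \<Psi> \<tau>) $ c\<bar>) \<in> O[at 0](\<lambda>\<tau>. \<tau> ^ (p + 1))"
    by (intro big_sum_in_bigo landau_o.big.abs_in_iff[THEN iffD2] main)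
  finally show ?thesis .
qed

end
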